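(* Let $\kappa$ be a measurable cardinal and let $\tau=(2^\kappa)^+$. The following are equivalent: (α) $\kappa$ carries at least $\tau$-many (distinct) normal ultrafilters. (β) There are $\tau$-many distinct $\kappa$-complete ultrafilters $(U_\alpha:\alpha<\tau)$ on $\kappa$ such that for every $\alpha<\tau$ there is a function $f_\alpha:\kappa\to\kappa$ with $[f_\alpha]_{U_\alpha}=\kappa$ which is $U_\alpha$-bounded, i.e. $|f_\alpha(A)\cap f_\alpha(\kappa\setminus A)|<\kappa$ for every $A\in U_\alpha$. Moreover, the equivalence remains true if in (β) the requirement that $f_\alpha$ be $U_\alpha$-bounded is replaced by the requirement that $f_\alpha$ be $(U_\alpha,U_\alpha^* )$-bounded, i.e. $f_\alpha(A)\cap f_\alpha(\kappa\setminus A)\notin U_\alpha^*$ for every $A\in U_\alpha$, where $U_\alpha^*=\{B\subseteq\kappa: f_\alpha^{-1}(B)\in U_\alpha\}$.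
   Context: All filters and ultrafilters are non-principal. An ultrafilter $U$ on $\kappa$ is $\kappa$-complete if it is closed under intersections of fewer than $\kappa$ of its members, and normal if it is closed under diagonal intersections of length $\kappa$. For a $\kappa$-complete ultrafilter $U$ on $\kappa$ and $f:\kappa\to\kappa$, $[f]_U$ denotes the ordinal represented by the equivalence class of $f$ in the (transitive collapse of the) ultrapower $\mathbf V^\kappa/U$. For $A\subseteq\kappa$, $f(A)=\{f(\xi):\xi\in A\}$. *)

theory Defs
  imports Main
begin

unbundle cardinal_syntax

text \<open>
  A cardinal \<open>\<kappa>\<close> is a relation with \<open>Card_order \<kappa>\<close>; its elements, the ordinals below it,
  are the members of \<open>Field \<kappa>\<close>, ordered by \<open>\<kappa>\<close>. Ordinals are well-orders up to \<open>=o\<close>.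
\<close>

definition filter_on :: "'a set \<Rightarrow> 'a set set \<Rightarrow> bool" where
  "filter_on K F \<longleftrightarrow>
     F \<subseteq> Pow K \<and> K \<in> F \<and> {} \<notin> F \<and>
     (\<forall>A\<in>F. \<forall>B\<in>F. A \<inter> B \<in> F) \<and>
     (\<forall>A\<in>F. \<forall>B. A \<subseteq> B \<and> B \<subseteq> K \<longrightarrow> B \<in> F)"

definition np_ultrafilter_on :: "'a set \<Rightarrow> 'a set set \<Rightarrow> bool" where
  "np_ultrafilter_on K U \<longleftrightarrow>
     filter_on K U \<and>
     (\<forall>A. A \<subseteq> K \<longrightarrow> A \<in> U \<or> K - A \<in> U) \<and>
     \<not> (\<exists>x\<in>K. U = {A. A \<subseteq> K \<and> x \<in> A})"

text \<open>The empty intersection is excluded because \<open>\<Inter>{} = UNIV\<close> need not be \<open>Field \<kappa>\<close>.\<close>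

definition complete_ultrafilter :: "'a rel \<Rightarrow> 'a set set \<Rightarrow> bool" where
  "complete_ultrafilter \<kappa> U \<longleftrightarrow>
     np_ultrafilter_on (Field \<kappa>) U \<and>
     (\<forall>S. S \<subseteq> U \<and> S \<noteq> {} \<and> |S| <o \<kappa> \<longrightarrow> \<Inter>S \<in> U)"

definition diag_Inter :: "'a rel \<Rightarrow> ('a \<Rightarrow> 'a set) \<Rightarrow> 'a set" where
  "diag_Inter \<kappa> X = {\<xi> \<in> Field \<kappa>. \<forall>\<alpha> \<in> underS \<kappa> \<xi>. \<xi> \<in> X \<alpha>}"

definition normal_ultrafilter :: "'a rel \<Rightarrow> 'a set set \<Rightarrow> bool" where
  "normal_ultrafilter \<kappa> U \<longleftrightarrow>
     np_ultrafilter_on (Field \<kappa>) U \<and>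
     (\<forall>X. (\<forall>\<alpha> \<in> Field \<kappa>. X \<alpha> \<in> U) \<longrightarrow> diag_Inter \<kappa> X \<in> U)"

definition measurable_cardinal :: "'a rel \<Rightarrow> bool" where
  "measurable_cardinal \<kappa> \<longleftrightarrow>
     Card_order \<kappa> \<and> natLeq <o \<kappa> \<and> (\<exists>U. complete_ultrafilter \<kappa> U)"

definition ultrapower_eq :: "'a rel \<Rightarrow> 'a set set \<Rightarrow> ('a \<Rightarrow> 'a) rel" where
  "ultrapower_eq \<kappa> U =
     {(g, h). g \<in> Func (Field \<kappa>) (Field \<kappa>) \<and> h \<in> Func (Field \<kappa>) (Field \<kappa>) \<and>
              {\<xi> \<in> Field \<kappa>. g \<xi> = h \<xi>} \<in> U}"

definition ultrapower_class :: "'a rel \<Rightarrow> 'a set set \<Rightarrow> ('a \<Rightarrow> 'a) \<Rightarrow> ('a \<Rightarrow> 'a) set" where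
  "ultrapower_class \<kappa> U f = ultrapower_eq \<kappa> U `` {f}"

definition ultrapower_le :: "'a rel \<Rightarrow> 'a set set \<Rightarrow> ('a \<Rightarrow> 'a) set rel" where
  "ultrapower_le \<kappa> U =
     {(ultrapower_class \<kappa> U g, ultrapower_class \<kappa> U h) | g h.
        g \<in> Func (Field \<kappa>) (Field \<kappa>) \<and> h \<in> Func (Field \<kappa>) (Field \<kappa>) \<and>
        {\<xi> \<in> Field \<kappa>. (g \<xi>, h \<xi>) \<in> \<kappa>} \<in> U}"

text \<open>
  The ordinal \<open>[f]\<^sub>U\<close>: in the transitive collapse, the class of \<open>f\<close> becomes the set of the
  collapsed classes below it, so it is the order type of its predecessors. For
  \<open>f : \<kappa> \<rightarrow> \<kappa>\<close>, every class of the full ultrapower of the universe below the class of \<open>f\<close>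
  has a representative \<open>\<kappa> \<rightarrow> \<kappa>\<close>, so functions into \<open>\<kappa>\<close> suffice.
\<close>

definition ultrapower_ord :: "'a rel \<Rightarrow> 'a set set \<Rightarrow> ('a \<Rightarrow> 'a) \<Rightarrow> ('a \<Rightarrow> 'a) set rel" where
  "ultrapower_ord \<kappa> U f =
     Restr (ultrapower_le \<kappa> U) (underS (ultrapower_le \<kappa> U) (ultrapower_class \<kappa> U f))"

definition bounded_fun :: "'a rel \<Rightarrow> 'a set set \<Rightarrow> ('a \<Rightarrow> 'a) \<Rightarrow> bool" where
  "bounded_fun \<kappa> U f \<longleftrightarrow> (\<forall>A\<in>U. |f ` A \<inter> f ` (Field \<kappa> - A)| <o \<kappa>)"

definition image_ultrafilter :: "'a rel \<Rightarrow> 'a set set \<Rightarrow> ('a \<Rightarrow> 'a) \<Rightarrow> 'a set set" where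
  "image_ultrafilter \<kappa> U f = {B. B \<subseteq> Field \<kappa> \<and> {\<xi> \<in> Field \<kappa>. f \<xi> \<in> B} \<in> U}"

definition star_bounded_fun :: "'a rel \<Rightarrow> 'a set set \<Rightarrow> ('a \<Rightarrow> 'a) \<Rightarrow> bool" where
  "star_bounded_fun \<kappa> U f \<longleftrightarrow>
     (\<forall>A\<in>U. f ` A \<inter> f ` (Field \<kappa> - A) \<notin> image_ultrafilter \<kappa> U f)"

end

theory Submission
  imports Defs
begin

text \<open>
  For a \<open>\<kappa>\<close>-complete ultrafilter \<open>U\<close>, \<open>[f]\<^sub>U = \<kappa>\<close> means that \<open>f\<close> exceeds every constant and that
  every function below \<open>f\<close> is constant, modulo \<open>U\<close>. Hence the image \<open>U\<^sup>*\<close> of \<open>U\<close> under \<open>f\<close> is normal, and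
  boundedness of \<open>f\<close> gives \<open>A \<in> U\<close> iff \<open>f(A) \<in> U\<^sup>*\<close>. So \<open>U\<close> is determined by the pair
  \<open>(f, U\<^sup>*)\<close>; as there are only \<open>2\<^sup>\<kappa>\<close> functions \<open>f\<close>, more than \<open>2\<^sup>\<kappa>\<close> ultrafilters \<open>U\<close> require
  more than \<open>2\<^sup>\<kappa>\<close> normal ones. Conversely, the identity works for every normal ultrafilter
  without bounded members, and since \<open>\<kappa>\<close> is a strong limit at most \<open>2\<^sup>\<kappa>\<close> normal ultrafilters
  have a bounded member.
\<close>

section \<open>Non-principal ultrafilters on a set\<close>

lemma Well_order_underS_iff:
  assumes r: "Well_order r" and a: "a \<in> Field r" and b: "b \<in> Field r"
  shows "a \<in> underS r b \<longleftrightarrow> (b, a) \<notin> r"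
proof -
  have tot: "(a, b) \<in> r \<or> (b, a) \<in> r" if "a \<noteq> b"
    using r a b that unfolding order_on_defs total_on_def by simp
  have refl: "(a, a) \<in> r" using r a unfolding order_on_defs refl_on_def by simp
  have "antisym r" using r unfolding order_on_defs by simp
  then show ?thesis using tot refl unfolding underS_def by (auto dest: antisymD)
qed

lemma np_ultrafilter_onD:
  assumes "np_ultrafilter_on K U"
  shows np_ultrafilter_subset: "A \<in> U \<Longrightarrow> A \<subseteq> K"
    and np_ultrafilter_top: "K \<in> U"
    and np_ultrafilter_empty: "{} \<notin> U"
    and np_ultrafilter_Int: "A \<in> U \<Longrightarrow> B \<in> U \<Longrightarrow> A \<inter> B \<in> U"
    and np_ultrafilter_mono: "A \<in> U \<Longrightarrow> A \<subseteq> B \<Longrightarrow> B \<subseteq> K \<Longrightarrow> B \<in> U"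
    and np_ultrafilter_cases: "A \<subseteq> K \<Longrightarrow> A \<in> U \<or> K - A \<in> U"
proof -
  have F: "U \<subseteq> Pow K" "K \<in> U" "{} \<notin> U" "\<forall>A\<in>U. \<forall>B\<in>U. A \<inter> B \<in> U"
    "\<forall>A\<in>U. \<forall>B. A \<subseteq> B \<and> B \<subseteq> K \<longrightarrow> B \<in> U" "\<forall>A. A \<subseteq> K \<longrightarrow> A \<in> U \<or> K - A \<in> U"
    using assms unfolding np_ultrafilter_on_def filter_on_def by simp_all
  show "A \<in> U \<Longrightarrow> A \<subseteq> K" using F(1) by blast
  show "K \<in> U" by (rule F(2))
  show "{} \<notin> U" by (rule F(3))
  show "A \<in> U \<Longrightarrow> B \<in> U \<Longrightarrow> A \<inter> B \<in> U" using F(4) by simp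
  show "A \<in> U \<Longrightarrow> A \<subseteq> B \<Longrightarrow> B \<subseteq> K \<Longrightarrow> B \<in> U" using F(5) by simp
  show "A \<subseteq> K \<Longrightarrow> A \<in> U \<or> K - A \<in> U" using F(6) by simp
qed

lemma np_ultrafilter_Diff_iff:
  assumes "np_ultrafilter_on K U" "A \<subseteq> K"
  shows "K - A \<in> U \<longleftrightarrow> A \<notin> U"
  using np_ultrafilter_cases[OF assms] np_ultrafilter_Int[OF assms(1), of A "K - A"]
    np_ultrafilter_empty[OF assms(1)]
  by auto

lemma np_ultrafilter_Int_iff:
  assumes "np_ultrafilter_on K U" "L \<in> U" "A \<subseteq> K"
  shows "A \<inter> L \<in> U \<longleftrightarrow> A \<in> U"
  using np_ultrafilter_Int[OF assms(1) _ assms(2)]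
    np_ultrafilter_mono[OF assms(1) _ Int_lower1 assms(3)] by blast

text \<open>Every member of \<open>U\<close> meets \<open>{x}\<close> as soon as \<open>{x}\<close>
  is a member, so \<open>U\<close> would be exactly the principal family that the definition
  excludes.\<close>

lemma np_ultrafilter_singleton:
  assumes U: "np_ultrafilter_on K U"
  shows "{x} \<notin> U"
proof
  assume x: "{x} \<in> U"
  then have xK: "x \<in> K" using np_ultrafilter_subset[OF U] by blast
  have "U = {A. A \<subseteq> K \<and> x \<in> A}"
  proof (intro set_eqI iffI)
    fix A assume A: "A \<in> U"
    then have "A \<inter> {x} \<noteq> {}"
      using np_ultrafilter_Int[OF U A x] np_ultrafilter_empty[OF U] by metis
    then show "A \<in> {A. A \<subseteq> K \<and> x \<in> A}" using np_ultrafilter_subset[OF U A] by blast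
  next
    fix A assume "A \<in> {A. A \<subseteq> K \<and> x \<in> A}"
    then show "A \<in> U" using np_ultrafilter_mono[OF U x] by blast
  qed
  then show False using U xK unfolding np_ultrafilter_on_def by blast
qed

text \<open>Absence of singletons stands in for non-principality, because for an image ultrafilter
  it can be read off the fibres of the function.\<close>

lemma np_ultrafilter_onI:
  assumes "\<And>A. A \<in> U \<Longrightarrow> A \<subseteq> K" "K \<in> U" "{} \<notin> U"
    and "\<And>A B. A \<in> U \<Longrightarrow> B \<in> U \<Longrightarrow> A \<inter> B \<in> U"
    and "\<And>A B. A \<in> U \<Longrightarrow> A \<subseteq> B \<Longrightarrow> B \<subseteq> K \<Longrightarrow> B \<in> U"
    and "\<And>A. A \<subseteq> K \<Longrightarrow> A \<in> U \<or> K - A \<in> U"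
    and "\<And>x. x \<in> K \<Longrightarrow> {x} \<notin> U"
  shows "np_ultrafilter_on K U"
proof -
  have "\<not> (\<exists>x\<in>K. U = {A. A \<subseteq> K \<and> x \<in> A})"
  proof
    assume "\<exists>x\<in>K. U = {A. A \<subseteq> K \<and> x \<in> A}"
    then obtain x where x: "x \<in> K" "U = {A. A \<subseteq> K \<and> x \<in> A}" by blast
    then have "{x} \<in> U" by simp
    then show False using assms(7) x(1) by blast
  qed
  moreover have "U \<subseteq> Pow K" using assms(1) by blast
  ultimately show ?thesis
    using assms(2-6) unfolding np_ultrafilter_on_def filter_on_def by simp
qed

subsection \<open>Complete ultrafilters\<close>

lemma complete_ultrafilter_np:
  "complete_ultrafilter \<kappa> U \<Longrightarrow> np_ultrafilter_on (Field \<kappa>) U"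
  unfolding complete_ultrafilter_def by blast

text \<open>Indexed form of completeness. Relativizing to \<open>Field \<kappa>\<close> gives the
  empty family its proper value, \<open>Field \<kappa>\<close> itself.\<close>

lemma complete_ultrafilter_INT:
  assumes U: "complete_ultrafilter \<kappa> U" and I: "|I| <o \<kappa>" and B: "\<And>i. i \<in> I \<Longrightarrow> B i \<in> U"
  shows "{\<xi> \<in> Field \<kappa>. \<forall>i\<in>I. \<xi> \<in> B i} \<in> U"
proof (cases "I = {}")
  case True
  then show ?thesis using np_ultrafilter_top[OF complete_ultrafilter_np[OF U]] by simp
next
  case False
  have "|B ` I| <o \<kappa>" using card_of_image I by (rule ordLeq_ordLess_trans)
  moreover have "B ` I \<subseteq> U" "B ` I \<noteq> {}" using B False by auto
  ultimately have "\<Inter>(B ` I) \<in> U"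
    using U unfolding complete_ultrafilter_def by metis
  moreover have "\<Inter>(B ` I) = {\<xi> \<in> Field \<kappa>. \<forall>i\<in>I. \<xi> \<in> B i}"
    using False B np_ultrafilter_subset[OF complete_ultrafilter_np[OF U]] by blast
  ultimately show ?thesis by simp
qed

text \<open>Otherwise the complements of the fewer than \<kappa> fibres over \<open>Y\<close> all
  lie in \<open>U\<close>; so does their intersection, which is disjoint from the set where
  \<open>g\<close> has its values in \<open>Y\<close>.\<close>

lemma complete_ultrafilter_const:
  assumes U: "complete_ultrafilter \<kappa> U" and Y: "|Y| <o \<kappa>"
    and g: "{\<xi> \<in> Field \<kappa>. g \<xi> \<in> Y} \<in> U"
  shows "\<exists>y\<in>Y. {\<xi> \<in> Field \<kappa>. g \<xi> = y} \<in> U"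
proof (rule ccontr)
  note np = complete_ultrafilter_np[OF U]
  assume "\<not> ?thesis"
  then have "Field \<kappa> - {\<xi> \<in> Field \<kappa>. g \<xi> = y} \<in> U" if "y \<in> Y" for y
    using that np_ultrafilter_Diff_iff[OF np, of "{\<xi> \<in> Field \<kappa>. g \<xi> = y}"] by blast
  from complete_ultrafilter_INT[OF U Y this]
  have "{\<xi> \<in> Field \<kappa>. \<forall>y\<in>Y. \<xi> \<in> Field \<kappa> - {\<xi> \<in> Field \<kappa>. g \<xi> = y}} \<in> U" .
  from np_ultrafilter_Int[OF np g this]
  have "{} \<in> U" by (rule back_subst[where P = "\<lambda>A. A \<in> U"]) blast
  then show False using np_ultrafilter_empty[OF np] by simp
qed

text \<open>If \<kappa> injected into \<open>Pow A\<close> by \<open>h\<close>, then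
  \<open>U\<close> would decide for each \<open>a\<close> whether \<open>a\<close> belongs to
  \<open>h \<xi>\<close>. By completeness these fewer than \<kappa> decisions hold simultaneously on
  a member of \<open>U\<close>. There \<open>h\<close> is constant, so by injectivity that member is
  a singleton.\<close>

lemma complete_ultrafilter_strong_limit:
  assumes U: "complete_ultrafilter \<kappa> U" and \<kappa>: "Card_order \<kappa>" and A: "|A| <o \<kappa>"
  shows "|Pow A| <o \<kappa>"
proof (rule ccontr)
  note np = complete_ultrafilter_np[OF U]
  assume "\<not> ?thesis"
  then have "\<kappa> \<le>o |Pow A|"
    using not_ordLess_iff_ordLeq[OF card_order_on_well_order_on[OF \<kappa>] card_of_Well_order] by blast
  then have "|Field \<kappa>| \<le>o |Pow A|"
    using card_of_Field_ordIso[OF \<kappa>] ordIso_ordLeq_trans by blast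
  then obtain h where h: "inj_on h (Field \<kappa>)" "h ` Field \<kappa> \<subseteq> Pow A"
    unfolding card_of_ordLeq[symmetric] by blast
  define B where "B a = (if {\<xi> \<in> Field \<kappa>. a \<in> h \<xi>} \<in> U then {\<xi> \<in> Field \<kappa>. a \<in> h \<xi>}
    else {\<xi> \<in> Field \<kappa>. a \<notin> h \<xi>})" for a
  have "Field \<kappa> - {\<xi> \<in> Field \<kappa>. a \<in> h \<xi>} = {\<xi> \<in> Field \<kappa>. a \<notin> h \<xi>}" for a by blast
  then have "B a \<in> U" for a
    using np_ultrafilter_cases[OF np, of "{\<xi> \<in> Field \<kappa>. a \<in> h \<xi>}"] unfolding B_def by auto
  then have I: "{\<xi> \<in> Field \<kappa>. \<forall>a\<in>A. \<xi> \<in> B a} \<in> U" (is "?I \<in> U")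
    by (rule complete_ultrafilter_INT[OF U A])
  then have "?I \<noteq> {}" using np_ultrafilter_empty[OF np] by metis
  then obtain x where x: "x \<in> ?I" by blast
  have "?I \<subseteq> {x}"
  proof
    fix y assume y: "y \<in> ?I"
    have "a \<in> h y \<longleftrightarrow> a \<in> h x" if "a \<in> A" for a
      using x y that unfolding B_def by (auto split: if_splits)
    then have "h y = h x" using x y h(2) by blast
    then show "y \<in> {x}" using x y h(1) by (auto dest: inj_onD)
  qed
  then have "{x} \<in> U" using np_ultrafilter_mono[OF np I] x by blast
  then show False using np_ultrafilter_singleton[OF np] by blast
qed

subsection \<open>The ultrapower\<close>

lemma ultrapower_class_eq_iff:
  assumes U: "np_ultrafilter_on (Field \<kappa>) U"
    and g: "g \<in> Func (Field \<kappa>) (Field \<kappa>)" and h: "h \<in> Func (Field \<kappa>) (Field \<kappa>)"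
  shows "ultrapower_class \<kappa> U g = ultrapower_class \<kappa> U h \<longleftrightarrow> {\<xi> \<in> Field \<kappa>. g \<xi> = h \<xi>} \<in> U"
proof
  assume "ultrapower_class \<kappa> U g = ultrapower_class \<kappa> U h"
  moreover have "h \<in> ultrapower_class \<kappa> U h"
    using h np_ultrafilter_top[OF U] unfolding ultrapower_class_def ultrapower_eq_def by simp
  ultimately have "h \<in> ultrapower_class \<kappa> U g" by simp
  then show "{\<xi> \<in> Field \<kappa>. g \<xi> = h \<xi>} \<in> U"
    unfolding ultrapower_class_def ultrapower_eq_def by simp
next
  assume gh: "{\<xi> \<in> Field \<kappa>. g \<xi> = h \<xi>} \<in> U"
  have "{\<xi> \<in> Field \<kappa>. g \<xi> = k \<xi>} \<in> U \<longleftrightarrow> {\<xi> \<in> Field \<kappa>. h \<xi> = k \<xi>} \<in> U" for k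
  proof -
    have "{\<xi> \<in> Field \<kappa>. g \<xi> = k \<xi>} \<inter> {\<xi> \<in> Field \<kappa>. g \<xi> = h \<xi>}
        = {\<xi> \<in> Field \<kappa>. h \<xi> = k \<xi>} \<inter> {\<xi> \<in> Field \<kappa>. g \<xi> = h \<xi>}" by auto
    then show ?thesis
      using np_ultrafilter_Int_iff[OF U gh, of "{\<xi> \<in> Field \<kappa>. g \<xi> = k \<xi>}"]
        np_ultrafilter_Int_iff[OF U gh, of "{\<xi> \<in> Field \<kappa>. h \<xi> = k \<xi>}"] by simp
  qed
  then show "ultrapower_class \<kappa> U g = ultrapower_class \<kappa> U h"
    using g h unfolding ultrapower_class_def ultrapower_eq_def by auto
qed

text \<open>The definition of \<open>ultrapower_le\<close> provides only some representatives of the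
  two classes; they agree with \<open>g\<close> and \<open>h\<close> on members of \<open>U\<close>,
  so the comparison does not depend on them.\<close>

lemma ultrapower_le_iff:
  assumes U: "np_ultrafilter_on (Field \<kappa>) U"
    and g: "g \<in> Func (Field \<kappa>) (Field \<kappa>)" and h: "h \<in> Func (Field \<kappa>) (Field \<kappa>)"
  shows "(ultrapower_class \<kappa> U g, ultrapower_class \<kappa> U h) \<in> ultrapower_le \<kappa> U \<longleftrightarrow>
    {\<xi> \<in> Field \<kappa>. (g \<xi>, h \<xi>) \<in> \<kappa>} \<in> U"
proof
  assume "(ultrapower_class \<kappa> U g, ultrapower_class \<kappa> U h) \<in> ultrapower_le \<kappa> U"
  then obtain g' h' where *: "g' \<in> Func (Field \<kappa>) (Field \<kappa>)" "h' \<in> Func (Field \<kappa>) (Field \<kappa>)"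
    "ultrapower_class \<kappa> U g = ultrapower_class \<kappa> U g'"
    "ultrapower_class \<kappa> U h = ultrapower_class \<kappa> U h'"
    "{\<xi> \<in> Field \<kappa>. (g' \<xi>, h' \<xi>) \<in> \<kappa>} \<in> U"
    unfolding ultrapower_le_def by blast
  have "{\<xi> \<in> Field \<kappa>. g \<xi> = g' \<xi>} \<in> U" "{\<xi> \<in> Field \<kappa>. h \<xi> = h' \<xi>} \<in> U"
    using *(3,4) ultrapower_class_eq_iff[OF U g *(1)] ultrapower_class_eq_iff[OF U h *(2)] by auto
  from np_ultrafilter_Int[OF U np_ultrafilter_Int[OF U this] *(5)]
   show "{\<xi> \<in> Field \<kappa>. (g \<xi>, h \<xi>) \<in> \<kappa>} \<in> U"
    by (rule np_ultrafilter_mono[OF U]) auto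
next
  assume "{\<xi> \<in> Field \<kappa>. (g \<xi>, h \<xi>) \<in> \<kappa>} \<in> U"
  then show "(ultrapower_class \<kappa> U g, ultrapower_class \<kappa> U h) \<in> ultrapower_le \<kappa> U"
    using g h unfolding ultrapower_le_def by blast
qed

text \<open>Since \<kappa> is linear, the complement of the set where \<open>h\<close> is strictly
  below \<open>g\<close> is the set where \<open>g\<close> is at most \<open>h\<close>. Combined
  with the description of the strict order, this makes the ultrapower order total.\<close>

lemma ultrapower_le_total:
  assumes U: "np_ultrafilter_on (Field \<kappa>) U" and \<kappa>: "Well_order \<kappa>"
    and g: "g \<in> Func (Field \<kappa>) (Field \<kappa>)" and h: "h \<in> Func (Field \<kappa>) (Field \<kappa>)"
  shows "(ultrapower_class \<kappa> U g, ultrapower_class \<kappa> U h) \<in> ultrapower_le \<kappa> U \<longleftrightarrow>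
    {\<xi> \<in> Field \<kappa>. h \<xi> \<in> underS \<kappa> (g \<xi>)} \<notin> U"
proof -
  have "Field \<kappa> - {\<xi> \<in> Field \<kappa>. h \<xi> \<in> underS \<kappa> (g \<xi>)} = {\<xi> \<in> Field \<kappa>. (g \<xi>, h \<xi>) \<in> \<kappa>}"
    using Well_order_underS_iff[OF \<kappa>] g h unfolding Func_def by blast
  then show ?thesis
    using ultrapower_le_iff[OF U g h]
      np_ultrafilter_Diff_iff[OF U, of "{\<xi> \<in> Field \<kappa>. h \<xi> \<in> underS \<kappa> (g \<xi>)}"] by auto
qed

lemma ultrapower_underS_iff:
  assumes U: "np_ultrafilter_on (Field \<kappa>) U" and \<kappa>: "Well_order \<kappa>"
    and g: "g \<in> Func (Field \<kappa>) (Field \<kappa>)" and h: "h \<in> Func (Field \<kappa>) (Field \<kappa>)"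
  shows "ultrapower_class \<kappa> U g \<in> underS (ultrapower_le \<kappa> U) (ultrapower_class \<kappa> U h) \<longleftrightarrow>
    {\<xi> \<in> Field \<kappa>. g \<xi> \<in> underS \<kappa> (h \<xi>)} \<in> U"
proof -
  have eq: "{\<xi> \<in> Field \<kappa>. g \<xi> \<in> underS \<kappa> (h \<xi>)}
    = {\<xi> \<in> Field \<kappa>. (g \<xi>, h \<xi>) \<in> \<kappa>} \<inter> (Field \<kappa> - {\<xi> \<in> Field \<kappa>. g \<xi> = h \<xi>})"
    unfolding underS_def by blast
  have "{\<xi> \<in> Field \<kappa>. g \<xi> \<in> underS \<kappa> (h \<xi>)} \<in> U \<longleftrightarrow>
    {\<xi> \<in> Field \<kappa>. (g \<xi>, h \<xi>) \<in> \<kappa>} \<in> U \<and> Field \<kappa> - {\<xi> \<in> Field \<kappa>. g \<xi> = h \<xi>} \<in> U"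
    unfolding eq
    by (intro iffI conjI; (elim conjE)?; (rule np_ultrafilter_Int[OF U] | erule np_ultrafilter_mono[OF U]))
      auto
  then show ?thesis
    using np_ultrafilter_Diff_iff[OF U, of "{\<xi> \<in> Field \<kappa>. g \<xi> = h \<xi>}"]
      ultrapower_class_eq_iff[OF U g h] ultrapower_le_iff[OF U g h]
    unfolding underS_def by auto
qed


text \<open>
  The classes of constant functions and the predecessors of the class of \<open>f\<close> are both initial
  segments of the ultrapower. If both have order type \<open>\<kappa>\<close> they coincide, because every proper
  initial segment of a cardinal \<open>\<kappa>\<close> has fewer than \<open>\<kappa>\<close> elements.
\<close>

lemma ultrapower_ord_eq_iff:
  assumes U: "complete_ultrafilter \<kappa> U" and \<kappa>: "Card_order \<kappa>"
    and f: "f \<in> Func (Field \<kappa>) (Field \<kappa>)"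
  shows "ultrapower_ord \<kappa> U f =o \<kappa> \<longleftrightarrow>
    (\<forall>\<alpha>\<in>Field \<kappa>. {\<xi> \<in> Field \<kappa>. \<alpha> \<in> underS \<kappa> (f \<xi>)} \<in> U) \<and>
    (\<forall>g\<in>Func (Field \<kappa>) (Field \<kappa>). {\<xi> \<in> Field \<kappa>. g \<xi> \<in> underS \<kappa> (f \<xi>)} \<in> U \<longrightarrow>
       (\<exists>\<alpha>\<in>Field \<kappa>. {\<xi> \<in> Field \<kappa>. g \<xi> = \<alpha>} \<in> U))"
    (is "_ \<longleftrightarrow> ?R")
proof -
  note np = complete_ultrafilter_np[OF U]
  have wo: "Well_order \<kappa>" using \<kappa> by (rule card_order_on_well_order_on)
  \<comment> \<open>Elements of \<open>Func\<close> are \<open>undefined\<close> off their domain,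
    so the constant function takes that default outside \<open>Field \<kappa>\<close>. The map
    \<open>c\<close> below embeds \<kappa> into the ultrapower by these constants.\<close>
  define k where "k \<alpha> = (\<lambda>\<xi>. if \<xi> \<in> Field \<kappa> then \<alpha> else undefined)" for \<alpha> :: 'a
  have k: "k \<alpha> \<in> Func (Field \<kappa>) (Field \<kappa>)" if "\<alpha> \<in> Field \<kappa>" for \<alpha>
    using that unfolding k_def Func_def by simp
  have k_app: "k \<alpha> \<xi> = \<alpha>" if "\<xi> \<in> Field \<kappa>" for \<alpha> \<xi>
    using that unfolding k_def by simp
  let ?cl = "ultrapower_class \<kappa> U"
  define c where "c \<alpha> = ?cl (k \<alpha>)" for \<alpha>
  define L where "L = ultrapower_le \<kappa> U"
  define P where "P = underS L (?cl f)"
  have ord: "ultrapower_ord \<kappa> U f = Restr L P"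
    unfolding ultrapower_ord_def L_def P_def ..
  have L_class: "\<exists>g\<in>Func (Field \<kappa>) (Field \<kappa>). x = ?cl g" if "(x, y) \<in> L" for x y
    using that unfolding L_def ultrapower_le_def by blast
  have P_class: "\<exists>g\<in>Func (Field \<kappa>) (Field \<kappa>). x = ?cl g" if "x \<in> P" for x
    using that L_class unfolding P_def underS_def by blast
  have P_iff: "?cl g \<in> P \<longleftrightarrow> {\<xi> \<in> Field \<kappa>. g \<xi> \<in> underS \<kappa> (f \<xi>)} \<in> U"
    if "g \<in> Func (Field \<kappa>) (Field \<kappa>)" for g
    using ultrapower_underS_iff[OF np wo that f] unfolding P_def L_def .
  have c_eq: "?cl g = c \<alpha> \<longleftrightarrow> {\<xi> \<in> Field \<kappa>. g \<xi> = \<alpha>} \<in> U"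
    if "g \<in> Func (Field \<kappa>) (Field \<kappa>)" "\<alpha> \<in> Field \<kappa>" for g \<alpha>
    using ultrapower_class_eq_iff[OF np that(1) k[OF that(2)]]
    unfolding c_def by (simp add: k_app cong: conj_cong)
  have c_P: "c \<alpha> \<in> P \<longleftrightarrow> {\<xi> \<in> Field \<kappa>. \<alpha> \<in> underS \<kappa> (f \<xi>)} \<in> U" if "\<alpha> \<in> Field \<kappa>" for \<alpha>
    using P_iff[OF k[OF that]] unfolding c_def by (simp add: k_app cong: conj_cong)
  have c_le: "(c \<alpha>, c \<beta>) \<in> L \<longleftrightarrow> (\<alpha>, \<beta>) \<in> \<kappa>" if "\<alpha> \<in> Field \<kappa>" "\<beta> \<in> Field \<kappa>" for \<alpha> \<beta>
  proof -
    have "(c \<alpha>, c \<beta>) \<in> L \<longleftrightarrow> {\<xi> \<in> Field \<kappa>. (\<alpha>, \<beta>) \<in> \<kappa>} \<in> U"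
      using ultrapower_le_iff[OF np k[OF that(1)] k[OF that(2)]]
      unfolding c_def L_def by (simp add: k_app cong: conj_cong)
    then show ?thesis using np_ultrafilter_top[OF np] np_ultrafilter_empty[OF np]
      by (cases "(\<alpha>, \<beta>) \<in> \<kappa>") simp_all
  qed
  have c_inj: "inj_on c (Field \<kappa>)"
  proof (rule inj_onI)
    fix \<alpha> \<beta> assume ab: "\<alpha> \<in> Field \<kappa>" "\<beta> \<in> Field \<kappa>" "c \<alpha> = c \<beta>"
    then have "{\<xi> \<in> Field \<kappa>. \<alpha> = \<beta>} \<in> U"
      using c_eq[OF k[OF ab(1)] ab(2)] unfolding c_def by (simp add: k_app cong: conj_cong)
    then show "\<alpha> = \<beta>" using np_ultrafilter_empty[OF np] by (cases "\<alpha> = \<beta>") simp_all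
  qed
  \<comment> \<open>The constants form an initial segment: a function below the constant \<beta>
    takes fewer than \<kappa> values modulo \<open>U\<close>, so completeness makes it
    constant.\<close>
  have down: "x \<in> c ` underS \<kappa> \<beta>" if \<beta>: "\<beta> \<in> Field \<kappa>" and x: "(x, c \<beta>) \<in> L" "x \<noteq> c \<beta>" for x \<beta>
  proof -
    obtain g where g: "g \<in> Func (Field \<kappa>) (Field \<kappa>)" "x = ?cl g" using L_class[OF x(1)] by blast
    have "?cl g \<in> underS L (c \<beta>)" using x g(2) unfolding underS_def by simp
    then have "{\<xi> \<in> Field \<kappa>. g \<xi> \<in> underS \<kappa> \<beta>} \<in> U"
      using ultrapower_underS_iff[OF np wo g(1) k[OF \<beta>]]
      unfolding c_def L_def by (simp add: k_app cong: conj_cong)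
    from complete_ultrafilter_const[OF U card_of_underS[OF \<kappa> \<beta>] this]
    obtain \<alpha> where "\<alpha> \<in> underS \<kappa> \<beta>" "{\<xi> \<in> Field \<kappa>. g \<xi> = \<alpha>} \<in> U" by blast
    moreover from this(1) have "\<alpha> \<in> Field \<kappa>" unfolding underS_def Field_def by blast
    ultimately show ?thesis using c_eq[OF g(1)] g(2) by blast
  qed
  \<comment> \<open>The first conjunct says that all constants are below \<open>f\<close>, the
    second that everything below \<open>f\<close> is constant.\<close>
  have R: "?R \<longleftrightarrow> c ` Field \<kappa> = P"
  proof
    assume ?R
    then show "c ` Field \<kappa> = P"
      using c_P c_eq P_iff P_class by (smt (verit) image_iff subsetI subset_antisym)
  next
    assume eq: "c ` Field \<kappa> = P"
    have "\<exists>\<alpha>\<in>Field \<kappa>. {\<xi> \<in> Field \<kappa>. g \<xi> = \<alpha>} \<in> U"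
      if "g \<in> Func (Field \<kappa>) (Field \<kappa>)" "{\<xi> \<in> Field \<kappa>. g \<xi> \<in> underS \<kappa> (f \<xi>)} \<in> U" for g
      using that P_iff[OF that(1)] c_eq[OF that(1)] eq by blast
    then show ?R using c_P eq by blast
  qed
  have "ultrapower_ord \<kappa> U f =o \<kappa>" if eq: "c ` Field \<kappa> = P"
  proof -
    \<comment> \<open>\<open>c\<close> preserves and reflects the order, so the predecessors of
      \<open>f\<close> are a copy of \<kappa> under \<open>c\<close>.\<close>
    have "Restr L P = dir_image \<kappa> c"
    proof
      show "Restr L P \<subseteq> dir_image \<kappa> c"
        using c_le unfolding dir_image_def eq[symmetric] by blast
      show "dir_image \<kappa> c \<subseteq> Restr L P"
        using c_le unfolding dir_image_def eq[symmetric] by (auto simp: FieldI1 FieldI2)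
    qed
    then show ?thesis
      using dir_image_ordIso[OF wo c_inj] unfolding ord by (simp add: ordIso_symmetric)
  qed
  moreover have "c ` Field \<kappa> = P" if iso: "ultrapower_ord \<kappa> U f =o \<kappa>"
  proof -
    define r where "r = Restr L P"
    have r: "r =o \<kappa>" using iso unfolding ord r_def .
    have cr: "Card_order r" using \<kappa> r by (rule Card_order_ordIso)
    have total: "(?cl g, ?cl h) \<in> L \<or> (?cl h, ?cl g) \<in> L"
      if "g \<in> Func (Field \<kappa>) (Field \<kappa>)" "h \<in> Func (Field \<kappa>) (Field \<kappa>)" for g h
      using ultrapower_le_total[OF np wo that] ultrapower_underS_iff[OF np wo that(2,1)]
      unfolding L_def underS_def by blast
    \<comment> \<open>Totality applied to two equal arguments gives reflexivity, so no element of
      \<open>P\<close> is missing from the field.\<close>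
    have Field_r: "Field r = P"
      using total P_class unfolding r_def Field_def by blast
    have card_P: "|P| =o \<kappa>"
      using card_of_Field_ordIso[OF cr] r unfolding Field_r by (rule ordIso_transitive)
    have card_C: "|c ` Field \<kappa>| =o \<kappa>"
      using card_of_Field_ordIso[OF \<kappa>] card_of_ordIso[of "c ` Field \<kappa>" "Field \<kappa>"]
        bij_betw_inv[OF inj_on_imp_bij_betw[OF c_inj]] ordIso_transitive by blast
    have P_down: "x \<in> P" if xy: "(x, y) \<in> L" "y \<in> P" for x y
    proof -
      obtain g h where gh: "g \<in> Func (Field \<kappa>) (Field \<kappa>)" "x = ?cl g"
          "h \<in> Func (Field \<kappa>) (Field \<kappa>)" "y = ?cl h"
        using L_class[OF xy(1)] P_class[OF xy(2)] by blast
      have "{\<xi> \<in> Field \<kappa>. (g \<xi>, h \<xi>) \<in> \<kappa>} \<in> U"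
        using ultrapower_le_iff[OF np gh(1,3)] xy(1) unfolding gh L_def by simp
      moreover have "{\<xi> \<in> Field \<kappa>. h \<xi> \<in> underS \<kappa> (f \<xi>)} \<in> U"
        using P_iff[OF gh(3)] xy(2) unfolding gh by simp
      ultimately have "{\<xi> \<in> Field \<kappa>. (g \<xi>, h \<xi>) \<in> \<kappa>} \<inter> {\<xi> \<in> Field \<kappa>. h \<xi> \<in> underS \<kappa> (f \<xi>)} \<in> U"
        by (rule np_ultrafilter_Int[OF np])
      moreover have "trans \<kappa>" "antisym \<kappa>" using wo unfolding order_on_defs by auto
      ultimately have "{\<xi> \<in> Field \<kappa>. g \<xi> \<in> underS \<kappa> (f \<xi>)} \<in> U"
        by (elim np_ultrafilter_mono[OF np]) (auto simp: underS_def dest: transD antisymD)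
      then show ?thesis using P_iff[OF gh(1)] unfolding gh by simp
    qed
    have CP: "c ` Field \<kappa> \<subseteq> P"
    proof (rule ccontr)
      assume "\<not> ?thesis"
      then obtain \<alpha> where \<alpha>: "\<alpha> \<in> Field \<kappa>" "c \<alpha> \<notin> P" by blast
      \<comment> \<open>\<open>P\<close> is downward closed, so a constant outside \<open>P\<close>
        lies above all of \<open>P\<close>. Then \<open>P\<close> consists of constants smaller than
        \<alpha> and is too small to have cardinality \<kappa>.\<close>
      have "P \<subseteq> c ` underS \<kappa> \<alpha>"
      proof
        fix x assume x: "x \<in> P"
        then obtain g where g: "g \<in> Func (Field \<kappa>) (Field \<kappa>)" "x = ?cl g" using P_class by blast
        have "(x, c \<alpha>) \<in> L"
          using total[OF g(1) k[OF \<alpha>(1)]] P_down[of "c \<alpha>" x] x \<alpha>(2) g(2) unfolding c_def by blast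
        then show "x \<in> c ` underS \<kappa> \<alpha>" using down[OF \<alpha>(1)] x \<alpha>(2) by blast
      qed
      then have "|P| \<le>o |underS \<kappa> \<alpha>|"
        by (rule ordLeq_transitive[OF card_of_mono1 card_of_image])
      then have "|P| <o \<kappa>" using card_of_underS[OF \<kappa> \<alpha>(1)] by (rule ordLeq_ordLess_trans)
      then show False using card_P not_ordLess_ordIso by blast
    qed
    moreover have "P \<subseteq> c ` Field \<kappa>"
    proof
      fix x assume x: "x \<in> P"
      show "x \<in> c ` Field \<kappa>"
      proof (rule ccontr)
        assume nx: "x \<notin> c ` Field \<kappa>"
        obtain g where g: "g \<in> Func (Field \<kappa>) (Field \<kappa>)" "x = ?cl g" using P_class x by blast
        \<comment> \<open>The constants are downward closed, so a non-constant \<open>x\<close> lies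
          above all of them. A proper initial segment of the cardinal order \<open>r\<close> would
          then have \<kappa> elements.\<close>
        have "c ` Field \<kappa> \<subseteq> underS r x"
        proof
          fix y assume "y \<in> c ` Field \<kappa>"
          then obtain \<alpha> where \<alpha>: "\<alpha> \<in> Field \<kappa>" "y = c \<alpha>" by blast
          have "(x, c \<alpha>) \<notin> L"
          proof
            assume "(x, c \<alpha>) \<in> L"
            then have "x \<in> c ` underS \<kappa> \<alpha>" using down[OF \<alpha>(1)] nx \<alpha>(1) by blast
            moreover have "underS \<kappa> \<alpha> \<subseteq> Field \<kappa>" unfolding underS_def Field_def by blast
            ultimately show False using nx by blast
          qed
          then have "(c \<alpha>, x) \<in> L" using total[OF g(1) k[OF \<alpha>(1)]] g(2) unfolding c_def by blast
          then show "y \<in> underS r x" using CP x nx \<alpha> unfolding underS_def r_def by blast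
        qed
        then have "|c ` Field \<kappa>| \<le>o |underS r x|" by (rule card_of_mono1)
        moreover have "|underS r x| <o r" using card_of_underS[OF cr] x Field_r by blast
        ultimately have "|c ` Field \<kappa>| <o r" by (rule ordLeq_ordLess_trans)
        then have "|c ` Field \<kappa>| <o \<kappa>" using r by (rule ordLess_ordIso_trans)
        then show False using card_C not_ordLess_ordIso by blast
      qed
    qed
    ultimately show ?thesis by blast
  qed
  ultimately show ?thesis unfolding R by blast
qed

subsection \<open>Image ultrafilters\<close>

lemma image_ultrafilter_np:
  assumes U: "np_ultrafilter_on (Field \<kappa>) U" and f: "f \<in> Func (Field \<kappa>) (Field \<kappa>)"
    and nonconst: "\<And>x. x \<in> Field \<kappa> \<Longrightarrow> {\<xi> \<in> Field \<kappa>. f \<xi> = x} \<notin> U"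
  shows "np_ultrafilter_on (Field \<kappa>) (image_ultrafilter \<kappa> U f)"
proof (rule np_ultrafilter_onI)
  show "Field \<kappa> \<in> image_ultrafilter \<kappa> U f"
  proof -
    have "{\<xi> \<in> Field \<kappa>. f \<xi> \<in> Field \<kappa>} = Field \<kappa>" using f unfolding Func_def by blast
    then show ?thesis using np_ultrafilter_top[OF U] unfolding image_ultrafilter_def by simp
  qed
  show "A \<inter> B \<in> image_ultrafilter \<kappa> U f"
    if "A \<in> image_ultrafilter \<kappa> U f" "B \<in> image_ultrafilter \<kappa> U f" for A B
  proof -
    have "{\<xi> \<in> Field \<kappa>. f \<xi> \<in> A} \<inter> {\<xi> \<in> Field \<kappa>. f \<xi> \<in> B} = {\<xi> \<in> Field \<kappa>. f \<xi> \<in> A \<inter> B}" by blast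
    then show ?thesis
      using that np_ultrafilter_Int[OF U, of "{\<xi> \<in> Field \<kappa>. f \<xi> \<in> A}" "{\<xi> \<in> Field \<kappa>. f \<xi> \<in> B}"]
      unfolding image_ultrafilter_def by auto
  qed
  show "B \<in> image_ultrafilter \<kappa> U f"
    if "A \<in> image_ultrafilter \<kappa> U f" "A \<subseteq> B" "B \<subseteq> Field \<kappa>" for A B
  proof -
    have "{\<xi> \<in> Field \<kappa>. f \<xi> \<in> A} \<in> U" using that(1) unfolding image_ultrafilter_def by simp
    then have "{\<xi> \<in> Field \<kappa>. f \<xi> \<in> B} \<in> U"
      by (rule np_ultrafilter_mono[OF U]) (use that(2) in auto)
    then show ?thesis using that(3) unfolding image_ultrafilter_def by simp
  qed
  show "A \<in> image_ultrafilter \<kappa> U f \<or> Field \<kappa> - A \<in> image_ultrafilter \<kappa> U f"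
    if "A \<subseteq> Field \<kappa>" for A
  proof -
    have "{\<xi> \<in> Field \<kappa>. f \<xi> \<in> Field \<kappa> - A} = Field \<kappa> - {\<xi> \<in> Field \<kappa>. f \<xi> \<in> A}"
      using f unfolding Func_def by blast
    then show ?thesis
      using that np_ultrafilter_cases[OF U, of "{\<xi> \<in> Field \<kappa>. f \<xi> \<in> A}"]
      unfolding image_ultrafilter_def by auto
  qed
qed (use nonconst np_ultrafilter_empty[OF U] in \<open>auto simp: image_ultrafilter_def\<close>)

text \<open>The two halves of \<open>ultrapower_ord_eq_iff\<close> serve different purposes. That
  \<open>f\<close> exceeds all constants makes the image non-principal. That functions below
  \<open>f\<close> are constant gives diagonal intersections: were one missing, picking an index
  \<alpha> below \<open>f \<xi>\<close> with \<open>f \<xi>\<close> outside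
  \<open>X \<alpha>\<close> would be constant modulo \<open>U\<close>, contradicting that
  \<open>X \<alpha>\<close> is in the image.\<close>

lemma image_ultrafilter_normal:
  assumes U: "complete_ultrafilter \<kappa> U" and \<kappa>: "Card_order \<kappa>"
    and f: "f \<in> Func (Field \<kappa>) (Field \<kappa>)" and ord: "ultrapower_ord \<kappa> U f =o \<kappa>"
  shows "normal_ultrafilter \<kappa> (image_ultrafilter \<kappa> U f)"
proof -
  note np = complete_ultrafilter_np[OF U]
  have above: "{\<xi> \<in> Field \<kappa>. \<alpha> \<in> underS \<kappa> (f \<xi>)} \<in> U" if "\<alpha> \<in> Field \<kappa>" for \<alpha>
    using ord that unfolding ultrapower_ord_eq_iff[OF U \<kappa> f] by blast
  have regr: "\<exists>\<alpha>\<in>Field \<kappa>. {\<xi> \<in> Field \<kappa>. g \<xi> = \<alpha>} \<in> U"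
    if "g \<in> Func (Field \<kappa>) (Field \<kappa>)" "{\<xi> \<in> Field \<kappa>. g \<xi> \<in> underS \<kappa> (f \<xi>)} \<in> U" for g
    using ord that unfolding ultrapower_ord_eq_iff[OF U \<kappa> f] by blast
  have disj: "False" if "A \<in> U" "B \<in> U" "A \<inter> B = {}" for A B
    using np_ultrafilter_Int[OF np that(1,2)] np_ultrafilter_empty[OF np] that(3) by simp
  have "np_ultrafilter_on (Field \<kappa>) (image_ultrafilter \<kappa> U f)"
  proof (rule image_ultrafilter_np[OF np f])
    fix x assume x: "x \<in> Field \<kappa>"
    show "{\<xi> \<in> Field \<kappa>. f \<xi> = x} \<notin> U"
      using disj[OF above[OF x]] unfolding underS_def by blast
  qed
  moreover have "diag_Inter \<kappa> X \<in> image_ultrafilter \<kappa> U f"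
    if X: "\<forall>\<alpha>\<in>Field \<kappa>. X \<alpha> \<in> image_ultrafilter \<kappa> U f" for X
  proof (rule ccontr)
    assume "\<not> ?thesis"
    then have "{\<xi> \<in> Field \<kappa>. f \<xi> \<in> diag_Inter \<kappa> X} \<notin> U"
      unfolding image_ultrafilter_def diag_Inter_def by auto
    then have D: "Field \<kappa> - {\<xi> \<in> Field \<kappa>. f \<xi> \<in> diag_Inter \<kappa> X} \<in> U" (is "?D \<in> U")
      using np_ultrafilter_Diff_iff[OF np, of "{\<xi> \<in> Field \<kappa>. f \<xi> \<in> diag_Inter \<kappa> X}"] by auto
    \<comment> \<open>On \<open>?D\<close> this picks an index witnessing that
      \<open>f \<xi>\<close> is outside the diagonal intersection. The value \<open>f \<xi>\<close>
      elsewhere merely keeps \<open>g\<close> inside \<open>Field \<kappa>\<close>.\<close>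
    define g where "g \<xi> = (if \<xi> \<in> ?D then SOME \<alpha>. \<alpha> \<in> underS \<kappa> (f \<xi>) \<and> f \<xi> \<notin> X \<alpha>
      else if \<xi> \<in> Field \<kappa> then f \<xi> else undefined)" for \<xi>
    have g_D: "g \<xi> \<in> underS \<kappa> (f \<xi>)" "f \<xi> \<notin> X (g \<xi>)" if "\<xi> \<in> ?D" for \<xi>
    proof -
      have "\<exists>\<alpha>. \<alpha> \<in> underS \<kappa> (f \<xi>) \<and> f \<xi> \<notin> X \<alpha>"
        using that f unfolding diag_Inter_def Func_def by blast
      from someI_ex[OF this] that show "g \<xi> \<in> underS \<kappa> (f \<xi>)" "f \<xi> \<notin> X (g \<xi>)"
        unfolding g_def by simp_all
    qed
    have sub: "underS \<kappa> a \<subseteq> Field \<kappa>" for a unfolding underS_def Field_def by blast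
    have "g \<xi> \<in> Field \<kappa>" if "\<xi> \<in> Field \<kappa>" for \<xi>
    proof (cases "\<xi> \<in> ?D")
      case True
      then show ?thesis using g_D sub by blast
    next
      case False
      then show ?thesis using that f unfolding g_def Func_def by auto
    qed
    then have "g \<in> Func (Field \<kappa>) (Field \<kappa>)" unfolding Func_def by (simp add: g_def)
    moreover have "{\<xi> \<in> Field \<kappa>. g \<xi> \<in> underS \<kappa> (f \<xi>)} \<in> U"
      by (rule np_ultrafilter_mono[OF np D]) (use g_D in auto)
    ultimately obtain \<alpha> where \<alpha>: "\<alpha> \<in> Field \<kappa>" "{\<xi> \<in> Field \<kappa>. g \<xi> = \<alpha>} \<in> U"
      using regr by blast
    have "{\<xi> \<in> Field \<kappa>. f \<xi> \<in> X \<alpha>} \<in> U" using X \<alpha>(1) unfolding image_ultrafilter_def by blast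
    from disj[OF np_ultrafilter_Int[OF np this \<alpha>(2)] D] show False using g_D by blast
  qed
  ultimately show ?thesis unfolding normal_ultrafilter_def by blast
qed

text \<open>A set of size less than \<kappa> cannot be in the image ultrafilter: by completeness of
  \<open>U\<close> some fibre over it would be in \<open>U\<close>, which puts a singleton into the
  image.\<close>

lemma bounded_fun_imp_star_bounded_fun:
  assumes U: "complete_ultrafilter \<kappa> U" and \<kappa>: "Card_order \<kappa>"
    and f: "f \<in> Func (Field \<kappa>) (Field \<kappa>)" and ord: "ultrapower_ord \<kappa> U f =o \<kappa>"
    and bdd: "bounded_fun \<kappa> U f"
  shows "star_bounded_fun \<kappa> U f"
  unfolding star_bounded_fun_def
proof
  note np' = image_ultrafilter_normal[OF U \<kappa> f ord, unfolded normal_ultrafilter_def, THEN conjunct1]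
  fix A assume "A \<in> U"
  then have small: "|f ` A \<inter> f ` (Field \<kappa> - A)| <o \<kappa>" (is "|?Y| <o _")
    using bdd unfolding bounded_fun_def by blast
  show "?Y \<notin> image_ultrafilter \<kappa> U f"
  proof
    assume "?Y \<in> image_ultrafilter \<kappa> U f"
    then have Y: "?Y \<subseteq> Field \<kappa>" "{\<xi> \<in> Field \<kappa>. f \<xi> \<in> ?Y} \<in> U"
      unfolding image_ultrafilter_def by auto
    from complete_ultrafilter_const[OF U small Y(2)]
    obtain y where y: "y \<in> ?Y" "{\<xi> \<in> Field \<kappa>. f \<xi> = y} \<in> U" by blast
    then have "{y} \<in> image_ultrafilter \<kappa> U f" using Y(1) unfolding image_ultrafilter_def by auto
    then show False using np_ultrafilter_singleton[OF np'] by blast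
  qed
qed

text \<open>Members of \<open>U\<close> always have images in the image ultrafilter. Boundedness
  gives the converse: if \<open>A\<close> is not in \<open>U\<close>, its complement is, so the
  images of both would be members and so would their intersection.\<close>

lemma star_bounded_fun_determines:
  assumes U: "np_ultrafilter_on (Field \<kappa>) U" and f: "f \<in> Func (Field \<kappa>) (Field \<kappa>)"
    and np': "np_ultrafilter_on (Field \<kappa>) (image_ultrafilter \<kappa> U f)"
    and bdd: "star_bounded_fun \<kappa> U f" and A: "A \<subseteq> Field \<kappa>"
  shows "A \<in> U \<longleftrightarrow> f ` A \<in> image_ultrafilter \<kappa> U f"
proof -
  have image: "f ` B \<in> image_ultrafilter \<kappa> U f" if B: "B \<in> U" for B
  proof -
    have "{\<xi> \<in> Field \<kappa>. f \<xi> \<in> f ` B} \<in> U"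
      by (rule np_ultrafilter_mono[OF U B]) (use np_ultrafilter_subset[OF U B] in auto)
    moreover have "f ` B \<subseteq> Field \<kappa>" using np_ultrafilter_subset[OF U B] f unfolding Func_def by blast
    ultimately show ?thesis unfolding image_ultrafilter_def by simp
  qed
  have "A \<in> U" if fA: "f ` A \<in> image_ultrafilter \<kappa> U f"
  proof (rule ccontr)
    assume "A \<notin> U"
    then have cA: "Field \<kappa> - A \<in> U" using np_ultrafilter_cases[OF U A] by blast
    have "f ` (Field \<kappa> - A) \<inter> f ` A \<in> image_ultrafilter \<kappa> U f"
      using np_ultrafilter_Int[OF np' image[OF cA] fA] .
    moreover have "Field \<kappa> - (Field \<kappa> - A) = A" using A by blast
    ultimately show False using bdd cA unfolding star_bounded_fun_def by metis
  qed
  then show ?thesis using image by blast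
qed

subsection \<open>Normal ultrafilters\<close>

lemma normal_ultrafilter_np:
  "normal_ultrafilter \<kappa> U \<Longrightarrow> np_ultrafilter_on (Field \<kappa>) U"
  unfolding normal_ultrafilter_def by blast

text \<open>Normality in the form of Fodor's lemma. If no fibre of \<open>g\<close> is in
  \<open>U\<close>, the diagonal intersection of their complements is, and on it \<open>g\<close> is
  nowhere regressive.\<close>

lemma normal_ultrafilter_regressive:
  assumes U: "normal_ultrafilter \<kappa> U" and g: "{\<xi> \<in> Field \<kappa>. g \<xi> \<in> underS \<kappa> \<xi>} \<in> U"
  shows "\<exists>\<alpha>\<in>Field \<kappa>. {\<xi> \<in> Field \<kappa>. g \<xi> = \<alpha>} \<in> U"
proof (rule ccontr)
  note np = normal_ultrafilter_np[OF U]
  assume none: "\<not> ?thesis"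
  define X where "X \<alpha> = Field \<kappa> - {\<xi> \<in> Field \<kappa>. g \<xi> = \<alpha>}" for \<alpha>
  have "X \<alpha> \<in> U" if "\<alpha> \<in> Field \<kappa>" for \<alpha>
    using that none np_ultrafilter_Diff_iff[OF np, of "{\<xi> \<in> Field \<kappa>. g \<xi> = \<alpha>}"]
    unfolding X_def by auto
  then have "diag_Inter \<kappa> X \<in> U" using U unfolding normal_ultrafilter_def by simp
  from np_ultrafilter_Int[OF np g this]
  have "{} \<in> U"
    by (rule back_subst[where P = "\<lambda>A. A \<in> U"]) (auto simp: diag_Inter_def X_def)
  then show False using np_ultrafilter_empty[OF np] by simp
qed

text \<open>
  A normal ultrafilter, being merely non-principal, may concentrate on a smaller measurable
  cardinal; the uniform ones are those that contain no initial segment.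
\<close>

definition uniform_normal :: "'a rel \<Rightarrow> 'a set set \<Rightarrow> bool" where
  "uniform_normal \<kappa> U \<longleftrightarrow> normal_ultrafilter \<kappa> U \<and> (\<forall>\<mu>\<in>Field \<kappa>. underS \<kappa> \<mu> \<notin> U)"

lemma uniform_normal_tail:
  assumes U: "uniform_normal \<kappa> U" and \<kappa>: "Well_order \<kappa>" and \<alpha>: "\<alpha> \<in> Field \<kappa>"
  shows "{\<xi> \<in> Field \<kappa>. \<alpha> \<in> underS \<kappa> \<xi>} \<in> U"
proof -
  have np: "np_ultrafilter_on (Field \<kappa>) U"
    using U normal_ultrafilter_np unfolding uniform_normal_def by blast
  have sub: "underS \<kappa> \<alpha> \<subseteq> Field \<kappa>" unfolding underS_def Field_def by blast
  have "Field \<kappa> - underS \<kappa> \<alpha> \<in> U"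
    using U \<alpha> np_ultrafilter_Diff_iff[OF np sub] unfolding uniform_normal_def by blast
  \<comment> \<open>Removing \<open>underS \<kappa> \<alpha>\<close> leaves \<alpha> itself, which
    has to go too for the strict inequality.\<close>
  moreover have "Field \<kappa> - {\<alpha>} \<in> U"
    using \<alpha> np_ultrafilter_Diff_iff[OF np, of "{\<alpha>}"] np_ultrafilter_singleton[OF np] by simp
  ultimately have "(Field \<kappa> - underS \<kappa> \<alpha>) \<inter> (Field \<kappa> - {\<alpha>}) \<in> U"
    by (rule np_ultrafilter_Int[OF np])
  then show ?thesis
    by (rule np_ultrafilter_mono[OF np])
      (use Well_order_underS_iff[OF \<kappa> _ \<alpha>] in \<open>auto simp: underS_def\<close>)
qed

text \<open>Codes a small family by ordinals below one bound \<open>a\<close>, so that a choice from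
  the family becomes a regressive function above \<open>a\<close>.\<close>

lemma ordLess_inj_underS:
  assumes \<kappa>: "Well_order \<kappa>" and S: "|S| <o \<kappa>"
  obtains a e where "a \<in> Field \<kappa>" "inj_on e S" "e ` S \<subseteq> underS \<kappa> a"
proof -
  obtain a where a: "a \<in> Field \<kappa>" "|S| =o Restr \<kappa> (underS \<kappa> a)"
    using S ordLess_iff_ordIso_Restr[OF \<kappa> card_of_Well_order] by blast
  then obtain e where "iso |S| (Restr \<kappa> (underS \<kappa> a)) e" unfolding ordIso_def by blast
  then have "bij_betw e S (Field (Restr \<kappa> (underS \<kappa> a)))" unfolding iso_def by (simp add: Field_card_of)
  moreover have "Field (Restr \<kappa> (underS \<kappa> a)) \<subseteq> underS \<kappa> a" unfolding Field_def by blast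
  ultimately show thesis using that a(1) unfolding bij_betw_def by blast
qed

text \<open>If the intersection of \<open>S\<close> is not in \<open>U\<close>, send each point
  outside it to the code of some member of \<open>S\<close> omitting it. Codes are below
  \<open>a\<close>, and the tail above \<open>a\<close> is in \<open>U\<close> by uniformity, so
  this map is regressive on a member of \<open>U\<close>. Normality makes it constant, so a single
  member of \<open>S\<close> is disjoint from a member of \<open>U\<close>.\<close>

lemma uniform_normal_complete:
  assumes U: "uniform_normal \<kappa> U" and \<kappa>: "Well_order \<kappa>"
  shows "complete_ultrafilter \<kappa> U"
proof -
  have norm: "normal_ultrafilter \<kappa> U" using U unfolding uniform_normal_def by blast
  note np = normal_ultrafilter_np[OF norm]
  have "\<Inter>S \<in> U" if S: "S \<subseteq> U" "S \<noteq> {}" "|S| <o \<kappa>" for S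
  proof (rule ccontr)
    assume nU: "\<Inter>S \<notin> U"
    obtain a e where ae: "a \<in> Field \<kappa>" "inj_on e S" "e ` S \<subseteq> underS \<kappa> a"
      using ordLess_inj_underS[OF \<kappa> S(3)] .
    have sub: "\<Inter>S \<subseteq> Field \<kappa>" using S(1,2) np_ultrafilter_subset[OF np] by blast
    have D: "Field \<kappa> - \<Inter>S \<in> U" using nU np_ultrafilter_Diff_iff[OF np sub] by blast
    define B where "B \<xi> = (SOME A. A \<in> S \<and> \<xi> \<notin> A)" for \<xi>
    have B: "B \<xi> \<in> S" "\<xi> \<notin> B \<xi>" if "\<xi> \<notin> \<Inter>S" for \<xi>
    proof -
      have "\<exists>A. A \<in> S \<and> \<xi> \<notin> A" using that by blast
      from someI_ex[OF this] show "B \<xi> \<in> S" "\<xi> \<notin> B \<xi>" unfolding B_def by simp_all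
    qed
    have trans: "trans \<kappa>" and antisym: "antisym \<kappa>" using \<kappa> unfolding order_on_defs by simp_all
    have "{\<xi> \<in> Field \<kappa>. e (B \<xi>) \<in> underS \<kappa> \<xi>} \<in> U"
    proof (rule np_ultrafilter_mono[OF np np_ultrafilter_Int[OF np D uniform_normal_tail[OF U \<kappa> ae(1)]]])
      show "(Field \<kappa> - \<Inter>S) \<inter> {\<xi> \<in> Field \<kappa>. a \<in> underS \<kappa> \<xi>} \<subseteq> {\<xi> \<in> Field \<kappa>. e (B \<xi>) \<in> underS \<kappa> \<xi>}"
      proof
        fix \<xi> assume \<xi>: "\<xi> \<in> (Field \<kappa> - \<Inter>S) \<inter> {\<xi> \<in> Field \<kappa>. a \<in> underS \<kappa> \<xi>}"
        then have "e (B \<xi>) \<in> underS \<kappa> a" "a \<in> underS \<kappa> \<xi>" using B(1) ae(3) by auto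
        then have "e (B \<xi>) \<in> underS \<kappa> \<xi>"
          using trans antisym unfolding underS_def by (auto dest: transD antisymD)
        then show "\<xi> \<in> {\<xi> \<in> Field \<kappa>. e (B \<xi>) \<in> underS \<kappa> \<xi>}" using \<xi> by simp
      qed
    qed blast
    from normal_ultrafilter_regressive[OF norm this]
    obtain \<alpha> where "{\<xi> \<in> Field \<kappa>. e (B \<xi>) = \<alpha>} \<in> U" by blast
    from np_ultrafilter_Int[OF np D this]
    have E: "(Field \<kappa> - \<Inter>S) \<inter> {\<xi> \<in> Field \<kappa>. e (B \<xi>) = \<alpha>} \<in> U" (is "?E \<in> U") .
    then have "?E \<noteq> {}" using np_ultrafilter_empty[OF np] by metis
    then obtain \<xi>\<^sub>0 where \<xi>\<^sub>0: "\<xi>\<^sub>0 \<notin> \<Inter>S" "e (B \<xi>\<^sub>0) = \<alpha>" by blast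
    have "B \<xi> = B \<xi>\<^sub>0" if "\<xi> \<in> ?E" for \<xi>
      using inj_onD[OF ae(2), of "B \<xi>" "B \<xi>\<^sub>0"] B(1) \<xi>\<^sub>0 that by blast
    then have "?E \<inter> B \<xi>\<^sub>0 = {}" using B(2) by blast
    moreover have "?E \<inter> B \<xi>\<^sub>0 \<in> U" using np_ultrafilter_Int[OF np E] B(1)[OF \<xi>\<^sub>0(1)] S(1) by blast
    ultimately show False using np_ultrafilter_empty[OF np] by simp
  qed
  then show ?thesis using np unfolding complete_ultrafilter_def by simp
qed

text \<open>The identity is the witness. Uniformity puts it above the constants, Fodor's lemma makes
  everything below it constant, and disjoint sets have disjoint images.\<close>

lemma uniform_normal_identity:
  assumes U: "uniform_normal \<kappa> U" and \<kappa>: "Card_order \<kappa>"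
  shows "\<exists>f\<in>Func (Field \<kappa>) (Field \<kappa>). ultrapower_ord \<kappa> U f =o \<kappa> \<and> bounded_fun \<kappa> U f"
proof -
  have wo: "Well_order \<kappa>" using \<kappa> by (rule card_order_on_well_order_on)
  have norm: "normal_ultrafilter \<kappa> U" using U unfolding uniform_normal_def by blast
  note compl = uniform_normal_complete[OF U wo]
  note np = normal_ultrafilter_np[OF norm]
  define f where "f \<xi> = (if \<xi> \<in> Field \<kappa> then \<xi> else undefined)" for \<xi>
  have f: "f \<in> Func (Field \<kappa>) (Field \<kappa>)" unfolding f_def Func_def by simp
  have f_app: "f \<xi> = \<xi>" if "\<xi> \<in> Field \<kappa>" for \<xi> using that unfolding f_def by simp
  have "ultrapower_ord \<kappa> U f =o \<kappa>"
    unfolding ultrapower_ord_eq_iff[OF compl \<kappa> f]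
    using uniform_normal_tail[OF U wo] normal_ultrafilter_regressive[OF norm]
    by (simp add: f_app cong: conj_cong)
  moreover have "bounded_fun \<kappa> U f"
  proof -
    have "f ` A \<inter> f ` (Field \<kappa> - A) = {}" if "A \<in> U" for A
      using np_ultrafilter_subset[OF np that] by (auto simp: f_app subset_iff)
    \<comment> \<open>Needed for the empty overlap to be of size strictly less than
      \<kappa>.\<close>
    moreover have "Field \<kappa> \<noteq> {}"
      using np_ultrafilter_top[OF np] np_ultrafilter_empty[OF np] by metis
    then have "|{} :: 'a set| <o |Field \<kappa>|"
      using card_of_ordLess2[of "Field \<kappa>" "{} :: 'a set"] by simp
    then have "|{} :: 'a set| <o \<kappa>" using card_of_Field_ordIso[OF \<kappa>] by (rule ordLess_ordIso_trans)
    ultimately show ?thesis unfolding bounded_fun_def by simp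
  qed
  ultimately show ?thesis using f by blast
qed

subsection \<open>Counting\<close>

lemma card_of_Pow_mono_ordLeq:
  assumes "|A| \<le>o |B|"
  shows "|Pow A| \<le>o |Pow B|"
proof -
  obtain h where h: "inj_on h A" "h ` A \<subseteq> B" using assms unfolding card_of_ordLeq[symmetric] by blast
  have "inj_on ((`) h) (Pow A)" using h(1) by (rule inj_on_image_Pow)
  moreover have "(`) h ` Pow A \<subseteq> Pow B" using h(2) by blast
  ultimately show ?thesis unfolding card_of_ordLeq[symmetric] by blast
qed

lemma card_of_Func_self_ordLeq:
  assumes "Cinfinite \<kappa>"
  shows "|Func (Field \<kappa>) (Field \<kappa>)| \<le>o ctwo ^c \<kappa>"
proof -
  have \<kappa>: "Card_order \<kappa>" using assms by blast
  have "|Func (Field \<kappa>) (Field \<kappa>)| = \<kappa> ^c \<kappa>" unfolding cexp_def ..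
  moreover have "\<kappa> ^c \<kappa> \<le>o (ctwo ^c \<kappa>) ^c \<kappa>"
    using cexp_mono1[OF ordLess_imp_ordLeq[OF ordLess_ctwo_cexp[OF \<kappa>]] \<kappa>] .
  moreover have "(ctwo ^c \<kappa>) ^c \<kappa> =o ctwo ^c \<kappa>"
    using cexp_cprod_ordLeq[OF Card_order_ctwo assms Cinfinite_Cnotzero[OF assms] ordLeq_refl[OF \<kappa>]] .
  ultimately show ?thesis using ordLeq_ordIso_trans by metis
qed

lemma measurable_cardinal_Cinfinite:
  assumes "measurable_cardinal \<kappa>"
  shows "Cinfinite \<kappa>"
proof -
  have "Card_order \<kappa>" "natLeq \<le>o \<kappa>"
    using assms ordLess_imp_ordLeq unfolding measurable_cardinal_def by blast+
  then show ?thesis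
    using cinfinite_mono natLeq_cinfinite by blast
qed

text \<open>Such an ultrafilter is determined by an initial segment belonging to it and its trace on
  that segment. There are \<kappa> segments, each with at most \<open>ctwo ^c \<kappa>\<close>
  traces because \<kappa> is a strong limit.\<close>

lemma card_of_nonuniform_normal:
  assumes "measurable_cardinal \<kappa>"
  shows "|{U. normal_ultrafilter \<kappa> U \<and> \<not> uniform_normal \<kappa> U}| \<le>o ctwo ^c \<kappa>" (is "|?N| \<le>o _")
proof -
  have \<kappa>: "Card_order \<kappa>" and inf: "Cinfinite \<kappa>"
    using measurable_cardinal_Cinfinite[OF assms] by blast+
  obtain V where V: "complete_ultrafilter \<kappa> V" using assms unfolding measurable_cardinal_def by blast
  define l where "l U = (SOME a. a \<in> Field \<kappa> \<and> underS \<kappa> a \<in> U)" for U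
  have l: "l U \<in> Field \<kappa>" "underS \<kappa> (l U) \<in> U" if "U \<in> ?N" for U
  proof -
    have "\<exists>a. a \<in> Field \<kappa> \<and> underS \<kappa> a \<in> U" using that unfolding uniform_normal_def by blast
    from someI_ex[OF this] show "l U \<in> Field \<kappa>" "underS \<kappa> (l U) \<in> U" unfolding l_def by simp_all
  qed
  define t where "t U = (l U, U \<inter> Pow (underS \<kappa> (l U)))" for U
  have "inj_on t ?N"
  proof (rule inj_onI)
    have *: "A \<in> W" if UW: "U \<in> ?N" "W \<in> ?N" "t U = t W" and A: "A \<in> U" for U W A
    proof -
      have npU: "np_ultrafilter_on (Field \<kappa>) U" and npW: "np_ultrafilter_on (Field \<kappa>) W"
        using UW normal_ultrafilter_np by blast+
      have "A \<inter> underS \<kappa> (l U) \<in> U \<inter> Pow (underS \<kappa> (l U))"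
        using np_ultrafilter_Int[OF npU A l(2)[OF UW(1)]] by blast
      \<comment> \<open>Equal codes mean equal segments and equal traces, so the part of
        \<open>A\<close> inside the segment passes from \<open>U\<close> to
        \<open>W\<close>.\<close>
      then have "A \<inter> underS \<kappa> (l U) \<in> W" using UW(3) unfolding t_def by auto
      then show ?thesis
        by (rule np_ultrafilter_mono[OF npW]) (use np_ultrafilter_subset[OF npU A] in auto)
    qed
    fix U W assume "U \<in> ?N" "W \<in> ?N" "t U = t W"
    then show "U = W" using *[of U W] *[of W U] by (intro equalityI subsetI) simp_all
  qed
  moreover have "t ` ?N \<subseteq> (SIGMA a:Field \<kappa>. Pow (Pow (underS \<kappa> a)))"
  proof
    fix x assume "x \<in> t ` ?N"
    then obtain U where U: "U \<in> ?N" "x = t U" by blast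
    show "x \<in> (SIGMA a:Field \<kappa>. Pow (Pow (underS \<kappa> a)))"
      unfolding U(2) t_def using l(1)[OF U(1)] by auto
  qed
  ultimately have "|?N| \<le>o |SIGMA a:Field \<kappa>. Pow (Pow (underS \<kappa> a))|"
    unfolding card_of_ordLeq[symmetric] by blast
  moreover have "|SIGMA a:Field \<kappa>. Pow (Pow (underS \<kappa> a))| \<le>o ctwo ^c \<kappa>"
  proof (rule card_of_Sigma_ordLeq_infinite_Field)
    show "\<not> finite (Field (ctwo ^c \<kappa>))"
      using Cinfinite_cexp[OF ordLeq_refl[OF Card_order_ctwo] inf] unfolding cinfinite_def by blast
    show "Card_order (ctwo ^c \<kappa>)" by (rule Card_order_cexp)
    show "|Field \<kappa>| \<le>o ctwo ^c \<kappa>"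
      using card_of_Field_ordIso[OF \<kappa>] ordLess_imp_ordLeq[OF ordLess_ctwo_cexp[OF \<kappa>]]
      by (rule ordIso_ordLeq_trans)
    show "\<forall>a\<in>Field \<kappa>. |Pow (Pow (underS \<kappa> a))| \<le>o ctwo ^c \<kappa>"
    proof
      fix a assume "a \<in> Field \<kappa>"
      \<comment> \<open>One power set stays below \<kappa>, hence the second one is at most the
        power set of \<kappa>.\<close>
      then have "|Pow (underS \<kappa> a)| <o \<kappa>"
        using complete_ultrafilter_strong_limit[OF V \<kappa>] card_of_underS[OF \<kappa>] by blast
      then have "|Pow (underS \<kappa> a)| \<le>o |Field \<kappa>|"
        using ordLess_imp_ordLeq ordLeq_ordIso_trans ordIso_symmetric[OF card_of_Field_ordIso[OF \<kappa>]]
        by blast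
      then have "|Pow (Pow (underS \<kappa> a))| \<le>o |Pow (Field \<kappa>)|" by (rule card_of_Pow_mono_ordLeq)
      moreover have "|Pow (Field \<kappa>)| =o ctwo ^c \<kappa>"
        unfolding ctwo_def cexp_def Field_card_of by (rule card_of_Pow_Func)
      ultimately show "|Pow (Pow (underS \<kappa> a))| \<le>o ctwo ^c \<kappa>" by (rule ordLeq_ordIso_trans)
    qed
  qed
  ultimately show ?thesis by (rule ordLeq_transitive)
qed

text \<open>Turns having at least \<tau> objects into the failure of an upper bound, so that both
  directions of the theorem become counting up to \<open>ctwo ^c \<kappa>\<close>.\<close>

lemma cardSuc_ordLeq_card_of_iff:
  assumes "Card_order r"
  shows "cardSuc r \<le>o |A| \<longleftrightarrow> \<not> |A| \<le>o r"
  using not_ordLess_iff_ordLeq[OF cardSuc_Well_order[OF assms] card_of_Well_order, of A]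
    cardSuc_ordLeq_ordLess[OF assms card_of_Card_order, of A] by blast

lemma many_normal_imp_many_bounded:
  fixes \<kappa> :: "'a rel"
  assumes meas: "measurable_cardinal \<kappa>" and \<tau>: "\<tau> = cardSuc (ctwo ^c \<kappa>)"
    and many: "\<tau> \<le>o |{U. normal_ultrafilter \<kappa> U}|"
  shows "\<exists>U :: ('a \<Rightarrow> bool) set \<Rightarrow> 'a set set. inj_on U (Field \<tau>) \<and>
    (\<forall>\<alpha>\<in>Field \<tau>. complete_ultrafilter \<kappa> (U \<alpha>) \<and>
       (\<exists>f\<in>Func (Field \<kappa>) (Field \<kappa>). ultrapower_ord \<kappa> (U \<alpha>) f =o \<kappa> \<and> bounded_fun \<kappa> (U \<alpha>) f))"
proof -
  have \<kappa>: "Card_order \<kappa>" and inf: "Cinfinite \<kappa>"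
    using measurable_cardinal_Cinfinite[OF meas] by blast+
  have wo: "Well_order \<kappa>" using \<kappa> by (rule card_order_on_well_order_on)
  have inf2: "\<not> finite (Field (ctwo ^c \<kappa>))"
    using Cinfinite_cexp[OF ordLeq_refl[OF Card_order_ctwo] inf] unfolding cinfinite_def by blast
  have eq: "{U. normal_ultrafilter \<kappa> U} =
      {U. uniform_normal \<kappa> U} \<union> {U. normal_ultrafilter \<kappa> U \<and> \<not> uniform_normal \<kappa> U}"
    unfolding uniform_normal_def by blast
  \<comment> \<open>Otherwise all normal ultrafilters would be a union of two families of size at
    most \<open>ctwo ^c \<kappa>\<close>.\<close>
  have "\<not> |{U. uniform_normal \<kappa> U}| \<le>o ctwo ^c \<kappa>"
    using card_of_Un_ordLeq_infinite_Field[OF inf2 _ card_of_nonuniform_normal[OF meas] Card_order_cexp]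
      many unfolding \<tau> cardSuc_ordLeq_card_of_iff[OF Card_order_cexp] eq by blast
  then have "\<tau> \<le>o |{U. uniform_normal \<kappa> U}|"
    unfolding \<tau> cardSuc_ordLeq_card_of_iff[OF Card_order_cexp] .
  moreover have "|Field \<tau>| =o \<tau>"
    unfolding \<tau> by (rule card_of_Field_ordIso[OF cardSuc_Card_order[OF Card_order_cexp]])
  ultimately have "|Field \<tau>| \<le>o |{U. uniform_normal \<kappa> U}|" using ordIso_ordLeq_trans by blast
  then obtain U where U: "inj_on U (Field \<tau>)" "U ` Field \<tau> \<subseteq> {U. uniform_normal \<kappa> U}"
    unfolding card_of_ordLeq[symmetric] by blast
  have "uniform_normal \<kappa> (U \<alpha>)" if "\<alpha> \<in> Field \<tau>" for \<alpha> using U(2) that by blast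
  then show ?thesis
    using U(1) uniform_normal_complete[OF _ wo] uniform_normal_identity[OF _ \<kappa>]
    by (intro exI[of _ U]) blast
qed

lemma many_star_bounded_imp_many_normal:
  fixes \<kappa> :: "'a rel" and U :: "('a \<Rightarrow> bool) set \<Rightarrow> 'a set set"
  assumes meas: "measurable_cardinal \<kappa>" and \<tau>: "\<tau> = cardSuc (ctwo ^c \<kappa>)"
    and inj: "inj_on U (Field \<tau>)"
    and U: "\<And>\<alpha>. \<alpha> \<in> Field \<tau> \<Longrightarrow> complete_ultrafilter \<kappa> (U \<alpha>)"
    and f: "\<And>\<alpha>. \<alpha> \<in> Field \<tau> \<Longrightarrow> \<exists>f\<in>Func (Field \<kappa>) (Field \<kappa>).
      ultrapower_ord \<kappa> (U \<alpha>) f =o \<kappa> \<and> star_bounded_fun \<kappa> (U \<alpha>) f"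
  shows "\<tau> \<le>o |{U. normal_ultrafilter \<kappa> U}|"
proof (rule ccontr)
  let ?F = "Func (Field \<kappa>) (Field \<kappa>)"
  have \<kappa>: "Card_order \<kappa>" and inf: "Cinfinite \<kappa>"
    using measurable_cardinal_Cinfinite[OF meas] by blast+
  have inf2: "\<not> finite (Field (ctwo ^c \<kappa>))"
    using Cinfinite_cexp[OF ordLeq_refl[OF Card_order_ctwo] inf] unfolding cinfinite_def by blast
  assume "\<not> ?thesis"
  then have few: "|{U. normal_ultrafilter \<kappa> U}| \<le>o ctwo ^c \<kappa>"
    unfolding \<tau> cardSuc_ordLeq_card_of_iff[OF Card_order_cexp] by blast
  from f obtain f where f: "\<And>\<alpha>. \<alpha> \<in> Field \<tau> \<Longrightarrow> f \<alpha> \<in> ?F"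
    "\<And>\<alpha>. \<alpha> \<in> Field \<tau> \<Longrightarrow> ultrapower_ord \<kappa> (U \<alpha>) (f \<alpha>) =o \<kappa>"
    "\<And>\<alpha>. \<alpha> \<in> Field \<tau> \<Longrightarrow> star_bounded_fun \<kappa> (U \<alpha>) (f \<alpha>)"
    by metis
  have norm: "normal_ultrafilter \<kappa> (image_ultrafilter \<kappa> (U \<alpha>) (f \<alpha>))" if "\<alpha> \<in> Field \<tau>" for \<alpha>
    using image_ultrafilter_normal[OF U[OF that] \<kappa> f(1,2)[OF that]] .
  \<comment> \<open>The pair recovers \<open>U \<alpha>\<close>, while its components range over at
    most \<open>ctwo ^c \<kappa>\<close> functions and, by assumption, at most
    \<open>ctwo ^c \<kappa>\<close> normal ultrafilters.\<close>
  define t where "t \<alpha> = (f \<alpha>, image_ultrafilter \<kappa> (U \<alpha>) (f \<alpha>))" for \<alpha>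
  have U_eq: "U \<alpha> = {A. A \<subseteq> Field \<kappa> \<and> fst (t \<alpha>) ` A \<in> snd (t \<alpha>)}" if "\<alpha> \<in> Field \<tau>" for \<alpha>
    using star_bounded_fun_determines[OF complete_ultrafilter_np[OF U[OF that]] f(1)[OF that]
        normal_ultrafilter_np[OF norm[OF that]] f(3)[OF that]]
      np_ultrafilter_subset[OF complete_ultrafilter_np[OF U[OF that]]]
    unfolding t_def by auto
  have "inj_on t (Field \<tau>)"
  proof (rule inj_onI)
    fix \<alpha> \<beta> assume ab: "\<alpha> \<in> Field \<tau>" "\<beta> \<in> Field \<tau>" "t \<alpha> = t \<beta>"
    then have "U \<alpha> = U \<beta>" using U_eq by simp
    then show "\<alpha> = \<beta>" using inj ab(1,2) by (auto dest: inj_onD)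
  qed
  moreover have "t ` Field \<tau> \<subseteq> ?F \<times> {U. normal_ultrafilter \<kappa> U}"
    using f(1) norm unfolding t_def by blast
  ultimately have "|Field \<tau>| \<le>o |?F \<times> {U. normal_ultrafilter \<kappa> U}|"
    unfolding card_of_ordLeq[symmetric] by blast
  moreover have "|?F \<times> {U. normal_ultrafilter \<kappa> U}| \<le>o ctwo ^c \<kappa>"
    using card_of_Times_ordLeq_infinite_Field[OF inf2 card_of_Func_self_ordLeq[OF inf] few Card_order_cexp] .
  ultimately have "|Field \<tau>| \<le>o ctwo ^c \<kappa>" by (rule ordLeq_transitive)
  moreover have "\<tau> =o |Field \<tau>|"
    unfolding \<tau>
    by (rule ordIso_symmetric[OF card_of_Field_ordIso[OF cardSuc_Card_order[OF Card_order_cexp]]])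
  ultimately have "\<tau> \<le>o ctwo ^c \<kappa>" using ordIso_ordLeq_trans by blast
  moreover have "ctwo ^c \<kappa> <o \<tau>" unfolding \<tau> by (rule cardSuc_greater[OF Card_order_cexp])
  ultimately show False using not_ordLess_ordLeq by blast
qed

theorem theorem2p3:
  fixes \<kappa> :: "'a rel" and \<tau> :: "('a \<Rightarrow> bool) set rel"
  assumes "measurable_cardinal \<kappa>"
    and "\<tau> = cardSuc (ctwo ^c \<kappa>)"
  shows "(\<tau> \<le>o |{U. normal_ultrafilter \<kappa> U}| \<longleftrightarrow>
           (\<exists>U :: ('a \<Rightarrow> bool) set \<Rightarrow> 'a set set.
              inj_on U (Field \<tau>) \<and>
              (\<forall>\<alpha>\<in>Field \<tau>. complete_ultrafilter \<kappa> (U \<alpha>) \<and>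
                 (\<exists>f\<in>Func (Field \<kappa>) (Field \<kappa>).
                    ultrapower_ord \<kappa> (U \<alpha>) f =o \<kappa> \<and> bounded_fun \<kappa> (U \<alpha>) f))))
       \<and> (\<tau> \<le>o |{U. normal_ultrafilter \<kappa> U}| \<longleftrightarrow>
           (\<exists>U :: ('a \<Rightarrow> bool) set \<Rightarrow> 'a set set.
              inj_on U (Field \<tau>) \<and>
              (\<forall>\<alpha>\<in>Field \<tau>. complete_ultrafilter \<kappa> (U \<alpha>) \<and>
                 (\<exists>f\<in>Func (Field \<kappa>) (Field \<kappa>).
                    ultrapower_ord \<kappa> (U \<alpha>) f =o \<kappa> \<and> star_bounded_fun \<kappa> (U \<alpha>) f))))"
proof -
  have \<kappa>: "Card_order \<kappa>" using assms(1) unfolding measurable_cardinal_def by blast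
  let ?\<alpha> = "\<tau> \<le>o |{U. normal_ultrafilter \<kappa> U}|"
  let ?\<beta> = "\<lambda>bd. \<exists>U :: ('a \<Rightarrow> bool) set \<Rightarrow> 'a set set. inj_on U (Field \<tau>) \<and>
    (\<forall>\<alpha>\<in>Field \<tau>. complete_ultrafilter \<kappa> (U \<alpha>) \<and>
       (\<exists>f\<in>Func (Field \<kappa>) (Field \<kappa>). ultrapower_ord \<kappa> (U \<alpha>) f =o \<kappa> \<and> bd \<kappa> (U \<alpha>) f))"
  \<comment> \<open>Three implications in a cycle, with the weaker notion of boundedness last, yield
    both equivalences.\<close>
  have "?\<beta> bounded_fun" if ?\<alpha>
    using many_normal_imp_many_bounded[OF assms that] .
  moreover have "?\<beta> star_bounded_fun" if "?\<beta> bounded_fun"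
    using that bounded_fun_imp_star_bounded_fun[OF _ \<kappa>] by meson
  moreover have ?\<alpha> if "?\<beta> star_bounded_fun"
    using that many_star_bounded_imp_many_normal[OF assms] by blast
  ultimately show ?thesis by argo
qed

end
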